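(* Let $\mathcal{B}_n(P)$ denote the set of t-shelves of size $n$ in which no node that is a left child of its parent has a right child (i.e. t-shelves avoiding the pattern $P$ given by the size-3 t-shelf with root $1$, left child $2$, and $3$ the right child of $2$). Let $c_{n,k}$ be the number of t-shelves in $\mathcal{B}_n(P)$ having exactly $k$ left children. Then $$\sum_{n\ge 0}\sum_{k\ge 0} c_{n,k}\,\frac{z^n y^k}{n!} = e^{\frac{e^{zy}-1}{y}}.$$
   Context: A treeshelf (t-shelf) of size $n\ge 1$ is a rooted binary tree with $n$ nodes labeled bijectively by $\{1,\dots,n\}$ so that labels strictly increase along every path starting at the root, in which every node has at most one left child and at most one right child, and every child (including a child with no sibling) is designated either as the left child or the right child of its parent. There is a unique empty t-shelf, of size $0$. A left child is a node that is the left child of its parent; the number of left children of a t-shelf is the number of such nodes. *)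

theory Defs
  imports
    "HOL-Library.Tree"
    "HOL-Computational_Algebra.Computational_Algebra"
begin

fun increasing_tree :: "nat tree \<Rightarrow> bool" where
  "increasing_tree Leaf \<longleftrightarrow> True"
| "increasing_tree (Node l x r) \<longleftrightarrow>
     (\<forall>y \<in> set_tree l \<union> set_tree r. x < y) \<and> increasing_tree l \<and> increasing_tree r"

text \<open>
  A tree with \<open>n\<close> nodes whose labels exhaust \<open>{1..n}\<close> is labelled bijectively.
\<close>

definition tshelves :: "nat \<Rightarrow> nat tree set" where
  "tshelves n = {t. size t = n \<and> set_tree t = {1..n} \<and> increasing_tree t}"

fun left_children :: "'a tree \<Rightarrow> nat" where
  "left_children Leaf = 0"
| "left_children (Node l x r) =
     (if l = Leaf then 0 else 1) + left_children l + left_children r"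

text \<open>
  Since \<open>left Leaf = Leaf\<close> and \<open>right Leaf = Leaf\<close>, the condition below is vacuous at every
  subtree \<open>s\<close> whose root has no left child.
\<close>

definition avoids_P :: "'a tree \<Rightarrow> bool" where
  "avoids_P t \<longleftrightarrow> (\<forall>s \<in> subtrees t. right (left s) = Leaf)"

definition tshelves_P :: "nat \<Rightarrow> nat tree set" where
  "tshelves_P n = {t \<in> tshelves n. avoids_P t}"

definition count_P :: "nat \<Rightarrow> nat \<Rightarrow> nat" where
  "count_P n k = card {t \<in> tshelves_P n. left_children t = k}"

lemma finite_trees_size_labels:
  assumes "finite A"
  shows "finite {t. size t = n \<and> set_tree t \<subseteq> A}"
proof (induction n rule: less_induct)
  case (less n)
  let ?S = "\<lambda>m. {t. size t = m \<and> set_tree t \<subseteq> A}"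
  let ?T = "\<Union>m<n. ?S m"
  have "?S n \<subseteq> insert Leaf ((\<lambda>(l, x, r). Node l x r) ` (?T \<times> A \<times> ?T))"
  proof
    fix t assume "t \<in> ?S n"
    then show "t \<in> insert Leaf ((\<lambda>(l, x, r). Node l x r) ` (?T \<times> A \<times> ?T))"
      by (cases t) (auto simp: image_iff)
  qed
  moreover have "finite ?T"
    using less by auto
  ultimately show ?case
    using assms by (meson finite.insertI finite_SigmaI finite_imageI finite_subset)
qed

lemma finite_tshelves: "finite (tshelves n)"
  by (rule finite_subset[OF _ finite_trees_size_labels[of "{1..n}" n]])
     (auto simp: tshelves_def)

text \<open>
  The bivariate exponential generating function of \<^const>\<open>count_P\<close>, as a formal power series
  in \<open>z\<close> whose coefficients are power series in \<open>y\<close>.  The latter are embedded into the field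
  of formal Laurent series in \<open>y\<close>, where \<open>y\<close> is \<^const>\<open>fls_X\<close>, so that division by \<open>y\<close> makes sense.
\<close>

definition egf_P :: "rat fls fps" where
  "egf_P = Abs_fps (\<lambda>n. fps_to_fls (Abs_fps (\<lambda>k. of_nat (count_P n k) / fact n)))"

end

theory Submission
  imports Defs
begin

text \<open>
  In a \<open>P\<close>-avoiding t-shelf the left subtree of the root is a path of left children, hence is
  determined by its label set \<open>A\<close> and contributes \<open>y ^ card A\<close>, while the right subtree is an arbitrary
  \<open>P\<close>-avoiding t-shelf on the remaining labels.  The generating function \<open>F\<close> therefore satisfies
  \<open>F' = e\<^bsup>zy\<^esup> F\<close> and \<open>F(0) = 1\<close>, and so does \<open>exp ((e\<^bsup>zy\<^esup> - 1) / y)\<close>.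
\<close>

fun left_path :: "'a list \<Rightarrow> 'a tree" where
  "left_path [] = Leaf"
| "left_path (x # xs) = Node (left_path xs) x Leaf"

lemma left_path_eq_Leaf_iff [simp]: "left_path xs = Leaf \<longleftrightarrow> xs = []"
  by (cases xs) auto

lemma set_tree_left_path [simp]: "set_tree (left_path xs) = set xs"
  by (induction xs) auto

lemma size_left_path [simp]: "size (left_path xs) = length xs"
  by (induction xs) auto

lemma left_children_left_path [simp]: "left_children (left_path xs) = length xs - 1"
  by (induction xs) auto

lemma increasing_tree_left_path [simp]:
  "increasing_tree (left_path xs) \<longleftrightarrow> sorted_wrt (<) xs"
  by (induction xs) auto

lemma avoids_P_Leaf [simp]: "avoids_P Leaf"
  by (simp add: avoids_P_def)

lemma avoids_P_Node [simp]:
  "avoids_P (Node l x r) \<longleftrightarrow> right l = Leaf \<and> avoids_P l \<and> avoids_P r"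
  by (auto simp: avoids_P_def)

lemma right_left_path [simp]: "right (left_path xs) = Leaf"
  by (cases xs) auto

lemma avoids_P_left_path [simp]: "avoids_P (left_path xs)"
  by (induction xs) auto

text \<open>An empty right subtree leaves only \<open>l\<close> below the root, and avoidance at the
  root makes \<open>right l\<close> empty in turn, so the hypothesis passes down the left
  spine.\<close>

lemma avoids_P_imp_left_path:
  "avoids_P t \<Longrightarrow> right t = Leaf \<Longrightarrow> \<exists>xs. t = left_path xs"
proof (induction t)
  case Leaf
  show ?case by (metis left_path.simps(1))
next
  case (Node l x r)
  then obtain xs where "l = left_path xs" by auto
  with Node.prems have "Node l x r = left_path (x # xs)" by simp
  then show ?case by blast
qed

text \<open>Arbitrary label sets are allowed because deleting the root and its left subtree leaves
  labels that need not form an interval. For finite \<open>S\<close>, the size condition forces the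
  labels to be distinct.\<close>

definition shelves_on :: "nat set \<Rightarrow> nat tree set" where
  "shelves_on S = {t. size t = card S \<and> set_tree t = S \<and> increasing_tree t \<and> avoids_P t}"

lemma card_set_tree_le_size: "card (set_tree t) \<le> size t"
  by (metis card_length length_inorder set_inorder)

lemma shelves_on_empty [simp]: "shelves_on {} = {Leaf}"
  by (auto simp: shelves_on_def)

lemma finite_shelves_on: "finite S \<Longrightarrow> finite (shelves_on S)"
  by (rule finite_subset[OF _ finite_trees_size_labels[of S "card S"]])
     (auto simp: shelves_on_def)

text \<open>Being below all other labels, \<open>m\<close> must sit at the root. The left subtree is
  a path, so it is fixed by its label set \<open>A\<close>, listed in increasing order from the
  top.\<close>

lemma shelves_on_insert:
  fixes m :: nat
  assumes "finite S" and less: "\<And>x. x \<in> S \<Longrightarrow> m < x"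
  shows "shelves_on (insert m S) =
    (\<lambda>(A, r). Node (left_path (sorted_list_of_set A)) m r) `
      (SIGMA A : Pow S. shelves_on (S - A))" (is "?L = ?f ` ?R")
proof (intro equalityI subsetI)
  fix t assume "t \<in> ?L"
  have m: "m \<notin> S" using less by blast
  from \<open>t \<in> ?L\<close> have t: "size t = Suc (card S)" "set_tree t = insert m S"
    "increasing_tree t" "avoids_P t"
    using m \<open>finite S\<close> by (auto simp: shelves_on_def)
  then obtain l x r where [simp]: "t = Node l x r" by (cases t) auto
  obtain xs where [simp]: "l = left_path xs"
    using t avoids_P_imp_left_path[of l] by auto
  have x: "x \<notin> set xs \<union> set_tree r" using t by auto
  have [simp]: "x = m"
  proof (rule ccontr)
    assume "x \<noteq> m"
    then have "x \<in> S" "m \<in> set xs \<union> set_tree r" using t(2) by auto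
    with t(3) have "x < m" by auto
    with less[OF \<open>x \<in> S\<close>] show False by simp
  qed
  have S: "S = set xs \<union> set_tree r" using t(2) x m by auto
  have "sorted_wrt (<) xs" using t by simp
  then have xs: "xs = sorted_list_of_set (set xs)"
    by (simp add: sorted_list_of_set.idem_if_sorted_distinct strict_sorted_iff)
  \<comment> \<open>Counting gives both disjointness and distinct labels in \<open>r\<close>: a
    label shared between \<open>xs\<close> and \<open>r\<close>, or repeated in \<open>r\<close>,
    would leave fewer than \<open>card S\<close> labels for \<open>card S\<close> nodes.\<close>
  have "card (set xs) = length xs"
    using \<open>sorted_wrt (<) xs\<close> by (simp add: distinct_card strict_sorted_iff)
  moreover have "length xs + size r = card S" using t by simp
  moreover have "card S + card (set xs \<inter> set_tree r) = card (set xs) + card (set_tree r)"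
    unfolding S using card_Un_Int[of "set xs" "set_tree r"] by simp
  moreover note card_set_tree_le_size[of r]
  ultimately have "card (set xs \<inter> set_tree r) = 0" and r: "size r = card (set_tree r)"
    by linarith+
  then have "S - set xs = set_tree r" using S by auto
  then have "(set xs, r) \<in> ?R" using S t r by (auto simp: shelves_on_def)
  moreover have "t = ?f (set xs, r)" by (simp flip: xs)
  ultimately show "t \<in> ?f ` ?R" by blast
next
  fix t assume "t \<in> ?f ` ?R"
  then obtain A r where A: "A \<subseteq> S" and r: "r \<in> shelves_on (S - A)"
    and [simp]: "t = Node (left_path (sorted_list_of_set A)) m r" by auto
  have "finite A" using A \<open>finite S\<close> finite_subset by blast
  moreover have "card A + card (S - A) = card S"
    using A \<open>finite S\<close> \<open>finite A\<close> by (simp add: card_Diff_subset card_mono)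
  moreover have "m \<notin> S" using less by blast
  ultimately show "t \<in> ?L"
    using A r less \<open>finite S\<close> by (auto simp: shelves_on_def)
qed

lemma sum_shelves_on_insert:
  fixes m :: nat and y :: "'a :: comm_semiring_1"
  assumes "finite S" and "\<And>x. x \<in> S \<Longrightarrow> m < x"
  shows "(\<Sum>t\<in>shelves_on (insert m S). y ^ left_children t) =
    (\<Sum>A\<in>Pow S. y ^ card A * (\<Sum>t\<in>shelves_on (S - A). y ^ left_children t))"
proof -
  let ?f = "\<lambda>(A, r). Node (left_path (sorted_list_of_set A)) m r"
  let ?R = "SIGMA A : Pow S. shelves_on (S - A)"
  have fin: "finite A" if "A \<subseteq> S" for A using that assms(1) finite_subset by blast
  have "inj_on ?f ?R"
  proof (rule inj_onI, clarsimp)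
    fix A B assume "A \<subseteq> S" "B \<subseteq> S"
      and eq: "left_path (sorted_list_of_set A) = left_path (sorted_list_of_set B)"
    from arg_cong[OF eq, of set_tree] show "A = B"
      using fin[OF \<open>A \<subseteq> S\<close>] fin[OF \<open>B \<subseteq> S\<close>] by simp
  qed
  then have "(\<Sum>t\<in>shelves_on (insert m S). y ^ left_children t) =
      (\<Sum>p\<in>?R. y ^ left_children (?f p))"
    by (simp add: shelves_on_insert[OF assms] sum.reindex)
  also have "\<dots> = (\<Sum>(A, r)\<in>?R. y ^ card A * y ^ left_children r)"
  proof (rule sum.cong[OF refl])
    fix p assume "p \<in> ?R"
    then obtain A r where p: "p = (A, r)" and "A \<subseteq> S" by auto
    \<comment> \<open>A nonempty path has \<open>card A - 1\<close> left children of its own, and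
      its top node is the left child of \<open>m\<close>. If \<open>A\<close> is empty, both
      contributions vanish.\<close>
    then have "left_children (?f (A, r)) = card A + left_children r"
      using fin[of A] by (cases "A = {}") (auto simp: card_gt_0_iff)
    then show "y ^ left_children (?f p) = (case p of (A, r) \<Rightarrow> y ^ card A * y ^ left_children r)"
      by (simp add: p power_add)
  qed
  also have "\<dots> = (\<Sum>A\<in>Pow S. \<Sum>r\<in>shelves_on (S - A). y ^ card A * y ^ left_children r)"
    using assms(1) by (subst sum.Sigma) (auto intro: finite_shelves_on)
  finally show ?thesis by (simp add: sum_distrib_left)
qed

lemma sum_Pow_card:
  fixes g :: "nat \<Rightarrow> 'a :: semiring_1"
  assumes "finite S"
  shows "(\<Sum>A\<in>Pow S. g (card A)) = (\<Sum>j\<le>card S. of_nat (card S choose j) * g j)"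
proof -
  have "(\<Sum>A\<in>Pow S. g (card A)) =
      (\<Sum>j\<le>card S. \<Sum>A\<in>{A \<in> Pow S. card A = j}. g (card A))"
    using assms by (intro sum.group[symmetric]) (auto intro: card_mono)
  also have "\<dots> = (\<Sum>j\<le>card S. of_nat (card S choose j) * g j)"
    using assms by (intro sum.cong) (auto simp: n_subsets)
  finally show ?thesis .
qed

text \<open>Splitting off the minimum gives a recurrence for the weighted counts, which is the
  coefficientwise form of the differential equation scaled by factorials. Keeping \<open>F\<close>
  abstract leaves only the equation and the initial value to be checked for the closed form.\<close>

lemma sum_shelves_on_eq:
  fixes y :: "'a :: field_char_0" and F :: "'a fps"
  assumes F0: "F $ 0 = 1" and deriv: "fps_deriv F = fps_exp y * F" and "finite S"
  shows "(\<Sum>t\<in>shelves_on S. y ^ left_children t) = fact (card S) * F $ card S"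
  using \<open>finite S\<close>
proof (induction "card S" arbitrary: S rule: less_induct)
  case (less S)
  show ?case
  proof (cases "S = {}")
    case True
    then show ?thesis by (simp add: F0)
  next
    case False
    define m S' where "m = Min S" and "S' = S - {m}"
    define n where "n = card S'"
    have m: "m \<in> S" using less.prems False by (simp add: m_def)
    then have S: "S = insert m S'" "m \<notin> S'" "finite S'" using less.prems by (auto simp: S'_def)
    then have card: "card S = Suc n" by (simp add: n_def)
    have "m < x" if "x \<in> S'" for x
      using that less.prems by (auto simp: S'_def m_def less_le)
    then have "(\<Sum>t\<in>shelves_on S. y ^ left_children t) =
        (\<Sum>A\<in>Pow S'. y ^ card A * (\<Sum>t\<in>shelves_on (S' - A). y ^ left_children t))"
      unfolding S(1) by (rule sum_shelves_on_insert[OF S(3)])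
    also have "\<dots> = (\<Sum>A\<in>Pow S'. y ^ card A * (fact (n - card A) * F $ (n - card A)))"
    proof (rule sum.cong[OF refl])
      fix A assume "A \<in> Pow S'"
      then have "card (S' - A) = n - card A"
        using S(3) by (simp add: n_def card_Diff_subset finite_subset)
      then show "y ^ card A * (\<Sum>t\<in>shelves_on (S' - A). y ^ left_children t) =
          y ^ card A * (fact (n - card A) * F $ (n - card A))"
        using less.hyps[of "S' - A"] card S(3) by simp
    qed
    also have "\<dots> = (\<Sum>j\<le>n. of_nat (n choose j) * (y ^ j * (fact (n - j) * F $ (n - j))))"
      using sum_Pow_card[OF S(3), of "\<lambda>j. y ^ j * (fact (n - j) * F $ (n - j))"]
      by (simp add: n_def)
    \<comment> \<open>Since \<open>(n choose j) * fact (n - j) = fact n / fact j\<close>, the sum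
      becomes a Cauchy product with the coefficients of \<open>fps_exp y\<close>.\<close>
    also have "\<dots> = fact n * (\<Sum>j\<le>n. y ^ j / fact j * F $ (n - j))"
      by (auto simp: sum_distrib_left binomial_fact intro!: sum.cong)
    also have "\<dots> = fact n * fps_deriv F $ n"
      by (simp add: deriv fps_mult_nth atLeast0AtMost)
    \<comment> \<open>Differentiation contributes the factor \<open>n + 1\<close>, which turns
      \<open>fact n\<close> into \<open>fact (Suc n)\<close>.\<close>
    also have "\<dots> = fact (card S) * F $ card S"
      by (simp add: card algebra_simps)
    finally show ?thesis .
  qed
qed

lemma tshelves_P_eq_shelves_on: "tshelves_P n = shelves_on {1..n}"
  by (auto simp: tshelves_P_def tshelves_def shelves_on_def)

lemma fps_to_fls_sum: "fps_to_fls (sum f A) = (\<Sum>x\<in>A. fps_to_fls (f x))"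
  by (induction A rule: infinite_finite_induct) auto

text \<open>Grouping shelves by their number of left children identifies the two sides. The
  comparison is made coefficientwise in power series in \<open>y\<close> and then carried over to
  Laurent series.\<close>

lemma egf_P_nth:
  "egf_P $ n = (\<Sum>t\<in>shelves_on {1..n}. fls_X ^ left_children t) / fact n"
proof -
  let ?T = "shelves_on {1..n}"
  have "Abs_fps (\<lambda>k. of_nat (count_P n k) / fact n :: rat) =
      fps_const (inverse (fact n)) * (\<Sum>t\<in>?T. fps_X ^ left_children t)"
  proof (rule fps_ext)
    fix k
    have "?T \<inter> {t. k = left_children t} = {t \<in> tshelves_P n. left_children t = k}"
      by (auto simp: tshelves_P_eq_shelves_on)
    then have "(\<Sum>t\<in>?T. if k = left_children t then 1 else 0 :: rat) = of_nat (count_P n k)"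
      by (simp add: count_P_def sum.If_cases finite_shelves_on)
    then show "Abs_fps (\<lambda>k. of_nat (count_P n k) / fact n :: rat) $ k =
        (fps_const (inverse (fact n)) * (\<Sum>t\<in>?T. fps_X ^ left_children t)) $ k"
      by (simp add: fps_sum_nth field_simps)
  qed
  then have "egf_P $ n =
      fls_const (inverse (fact n)) * (\<Sum>t\<in>?T. fls_X ^ left_children t)"
    by (simp add: egf_P_def fls_times_fps_to_fls fps_to_fls_sum fps_to_fls_power)
  also have "fls_const (inverse (fact n :: rat)) = inverse (fact n)"
    by (metis fls_inverse_const fls_of_nat of_nat_fact)
  finally show ?thesis by (simp add: divide_inverse mult.commute)
qed

theorem theorem1:
  "egf_P = fps_exp 1 oo ((fps_exp fls_X - 1) / fps_const fls_X)"
proof -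
  let ?G = "(fps_exp fls_X - 1) / fps_const fls_X :: rat fls fps"
  let ?F = "fps_exp 1 oo ?G"
  \<comment> \<open>As \<open>fls_X\<close> is invertible in the coefficient field, the quotient is
    a scaling. This form shows that the constant term is zero, as the chain rule and the initial
    value 1 require, and that the factor \<open>fls_X\<close> from differentiation cancels.\<close>
  have G: "?G = fps_const (inverse fls_X) * (fps_exp fls_X - 1)"
    by (simp add: fps_divide_unit fps_const_inverse mult.commute)
  have "fps_deriv ?G = fps_exp fls_X"
    by (simp add: G flip: mult.assoc)
  then have "fps_deriv ?F = fps_exp fls_X * ?F"
    by (simp add: G fps_compose_deriv mult.commute)
  then show ?thesis
    by (intro fps_ext) (simp add: egf_P_nth sum_shelves_on_eq[where F = ?F])
qed

end
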